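(* Let $(M,d)$ be a metric space with a distinguished point $0$. Then: (1) Assume that $M$ is the $\ell_1$ sum of two of its subsets $T_1,T_2$, i.e. $M=T_1\cup T_2$, $T_1\cap T_2=\{0\}$ and $d(x,y)=d(x,0)+d(0,y)$ for every $x\in T_1$ and every $y\in T_2$. Then $M$ has the LTP if, and only if, $T_1$ or $T_2$ has the LTP. (2) If $M$ has the LTP and $N_1$ is a subset of $M$ such that $M\setminus N_1$ is finite, then $N_1$ has the LTP.
   Context: A metric space $(M,d)$ has the long trapezoid property (LTP) if for each finite subset $N\subseteq M$ and each $\varepsilon>0$ there exist $u,v\in M$, $u\neq v$, such that $(1-\varepsilon)(d(x,y)+d(u,v))\leq d(x,u)+d(y,v)$ holds for all $x,y\in N$. Subsets of $M$ are regarded as metric spaces with the restricted metric. *)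

theory Defs
  imports "HOL-Analysis.Abstract_Metric_Spaces"
begin

text \<open>
  Metric spaces are given by a carrier set and a distance function, as in the locale
  \<^locale>\<open>Metric_space\<close>; a subset of the carrier with the restricted metric is then the
  subset together with the same distance function.
\<close>

definition long_trapezoid_property :: "'a set \<Rightarrow> ('a \<Rightarrow> 'a \<Rightarrow> real) \<Rightarrow> bool"
  where "long_trapezoid_property M d \<longleftrightarrow>
    (\<forall>N \<epsilon>. finite N \<and> N \<subseteq> M \<and> \<epsilon> > 0 \<longrightarrow>
      (\<exists>u\<in>M. \<exists>v\<in>M. u \<noteq> v \<and>
        (\<forall>x\<in>N. \<forall>y\<in>N. (1 - \<epsilon>) * (d x y + d u v) \<le> d x u + d y v)))"

definition is_l1_sum :: "'a set \<Rightarrow> ('a \<Rightarrow> 'a \<Rightarrow> real) \<Rightarrow> 'a \<Rightarrow> 'a set \<Rightarrow> 'a set \<Rightarrow> bool"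
  where "is_l1_sum M d z T\<^sub>1 T\<^sub>2 \<longleftrightarrow>
    M = T\<^sub>1 \<union> T\<^sub>2 \<and> T\<^sub>1 \<inter> T\<^sub>2 = {z} \<and> (\<forall>x\<in>T\<^sub>1. \<forall>y\<in>T\<^sub>2. d x y = d x z + d z y)"

end

(* For (1), points of T2 may be replaced by z when the pair u, v lies in T1. Conversely, if
   u is in T1 and v in T2, the one farther from z, paired with z, witnesses the LTP of its own
   summand at the price of doubling epsilon.

   For (2), remove one point p at a time. If all witnessing pairs for large N contain p, take
   such pairs (p, v) for N and (p, w) for N together with v. Then p lies approximately between
   v (or w) and each point of N, so (v, w) is a witnessing pair avoiding p. *)

theory Submission
  imports Defs
begin

section \<open>Witnessing pairs for a fixed finite set and tolerance\<close>

definition trapezoid_pair :: "('a \<Rightarrow> 'a \<Rightarrow> real) \<Rightarrow> 'a set \<Rightarrow> real \<Rightarrow> 'a \<Rightarrow> 'a \<Rightarrow> bool"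
  where "trapezoid_pair d N \<epsilon> u v \<longleftrightarrow>
    u \<noteq> v \<and> (\<forall>x\<in>N. \<forall>y\<in>N. (1 - \<epsilon>) * (d x y + d u v) \<le> d x u + d y v)"

lemma trapezoid_pairD:
  "trapezoid_pair d N \<epsilon> u v \<Longrightarrow> x \<in> N \<Longrightarrow> y \<in> N \<Longrightarrow>
    (1 - \<epsilon>) * (d x y + d u v) \<le> d x u + d y v"
  by (auto simp: trapezoid_pair_def)

lemma trapezoid_pair_subset:
  "trapezoid_pair d N \<epsilon> u v \<Longrightarrow> N' \<subseteq> N \<Longrightarrow> trapezoid_pair d N' \<epsilon> u v"
  unfolding trapezoid_pair_def by blast

lemma long_trapezoid_property_iff:
  "long_trapezoid_property M d \<longleftrightarrow>
    (\<forall>N \<epsilon>. finite N \<and> N \<subseteq> M \<and> \<epsilon> > 0 \<longrightarrow> (\<exists>u\<in>M. \<exists>v\<in>M. trapezoid_pair d N \<epsilon> u v))"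
  by (simp add: long_trapezoid_property_def trapezoid_pair_def)

lemma is_l1_sum_commute:
  assumes "Metric_space M d" "is_l1_sum M d z S T"
  shows "is_l1_sum M d z T S"
proof -
  interpret Metric_space M d by fact
  have "d x y = d x z + d z y" if "x \<in> T" "y \<in> S" for x y
  proof -
    have "d y x = d y z + d z x"
      using assms(2) that by (auto simp: is_l1_sum_def)
    then show ?thesis
      by (simp add: commute)
  qed
  then show ?thesis
    using assms(2) unfolding is_l1_sum_def by blast
qed

context Metric_space
begin

lemma trapezoid_pair_mono:
  assumes "trapezoid_pair d N \<epsilon> u v" "\<epsilon> \<le> \<epsilon>'"
  shows "trapezoid_pair d N \<epsilon>' u v"
proof -
  have "(1 - \<epsilon>') * (d x y + d u v) \<le> (1 - \<epsilon>) * (d x y + d u v)" for x y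
    using assms(2) by (intro mult_right_mono) auto
  then show ?thesis
    using assms(1) unfolding trapezoid_pair_def by (meson order_trans)
qed

lemma trapezoid_pair_sym:
  assumes "trapezoid_pair d N \<epsilon> u v"
  shows "trapezoid_pair d N \<epsilon> v u"
  unfolding trapezoid_pair_def
proof (intro conjI ballI)
  show "v \<noteq> u"
    using assms by (auto simp: trapezoid_pair_def)
  fix x y assume "x \<in> N" "y \<in> N"
  then show "(1 - \<epsilon>) * (d x y + d v u) \<le> d x v + d y u"
    using trapezoid_pairD[OF assms, of y x] by (simp add: commute add.commute)
qed

text \<open>A smaller tolerance gives a stronger condition, so \<open>min \<epsilon> (1/2)\<close>
  can stand in for \<epsilon>. With \<epsilon> < 1 the factor \<open>1 - \<epsilon>\<close> is
  positive and respects upper bounds on distances.\<close>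

lemma long_trapezoid_propertyI:
  assumes "\<And>N \<epsilon>. finite N \<Longrightarrow> N \<subseteq> S \<Longrightarrow> 0 < \<epsilon> \<Longrightarrow> \<epsilon> < 1 \<Longrightarrow>
    \<exists>u\<in>S. \<exists>v\<in>S. trapezoid_pair d N \<epsilon> u v"
  shows "long_trapezoid_property S d"
  unfolding long_trapezoid_property_iff
proof (intro allI impI)
  fix N and \<epsilon> :: real assume "finite N \<and> N \<subseteq> S \<and> \<epsilon> > 0"
  then have "\<exists>u\<in>S. \<exists>v\<in>S. trapezoid_pair d N (min \<epsilon> (1/2)) u v"
    by (intro assms) auto
  then show "\<exists>u\<in>S. \<exists>v\<in>S. trapezoid_pair d N \<epsilon> u v"
    by (meson trapezoid_pair_mono min.cobounded1)
qed

text \<open>Testing the inequality at \<open>u\<close> and \<open>v\<close> themselves makes the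
  right side zero and the left side positive.\<close>

lemma trapezoid_pair_not_mem:
  assumes "trapezoid_pair d N \<epsilon> u v" "\<epsilon> < 1" "u \<in> M" "v \<in> M" "u \<in> N"
  shows "v \<notin> N"
proof
  assume "v \<in> N"
  then have "(1 - \<epsilon>) * (d u v + d u v) \<le> 0"
    using trapezoid_pairD[OF assms(1), of u v] assms by simp
  moreover have "d u v > 0"
    using assms by (simp add: trapezoid_pair_def)
  ultimately show False
    using \<open>\<epsilon> < 1\<close> by (simp add: mult_le_0_iff)
qed

section \<open>Removing finitely many points\<close>

lemma long_trapezoid_property_remove1:
  assumes M: "long_trapezoid_property S d" and "S \<subseteq> M"
  shows "long_trapezoid_property (S - {p}) d"
proof (cases "p \<in> S")
  case False
  then show ?thesis using M by simp
next
  case True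
  show ?thesis
  proof (rule long_trapezoid_propertyI, rule ccontr)
    fix N and \<epsilon> :: real
    assume N: "finite N" "N \<subseteq> S - {p}" and \<epsilon>: "0 < \<epsilon>" "\<epsilon> < 1"
      and contra: "\<not> (\<exists>u\<in>S - {p}. \<exists>v\<in>S - {p}. trapezoid_pair d N \<epsilon> u v)"
    \<comment> \<open>A pair for \<open>K\<close> also serves the smaller set \<open>N\<close>, so
      \<open>contra\<close> forces it to contain \<open>p\<close>; symmetry puts \<open>p\<close>
      first.\<close>
    have ex: "\<exists>v\<in>S. trapezoid_pair d K \<epsilon> p v" if K: "finite K" "K \<subseteq> S" "N \<subseteq> K" for K
    proof -
      obtain u v where uv: "u \<in> S" "v \<in> S" "trapezoid_pair d K \<epsilon> u v"
        using M K \<epsilon> unfolding long_trapezoid_property_iff by meson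
      have "trapezoid_pair d N \<epsilon> u v"
        using uv(3) K(3) by (rule trapezoid_pair_subset)
      then consider "u = p" | "v = p"
        using contra uv(1,2) by blast
      then show ?thesis
        using uv trapezoid_pair_sym[OF uv(3)] by cases auto
    qed
    \<comment> \<open>Having \<open>p\<close> in the set allows a test at \<open>p\<close> and
      \<open>x\<close>, where \<open>d p p = 0\<close> leaves
      \<open>(1 - \<epsilon>) * (d p x + d p v) \<le> d x v\<close>.\<close>
    obtain v where v: "v \<in> S" and pv: "trapezoid_pair d (insert p N) \<epsilon> p v"
      using ex[of "insert p N"] N True by auto
    \<comment> \<open>Including \<open>v\<close> here forces \<open>w\<close> to differ from
      \<open>v\<close>, because \<open>p\<close> is in the set as well.\<close>
    obtain w where w: "w \<in> S" and pw: "trapezoid_pair d (insert v (insert p N)) \<epsilon> p w"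
      using ex[of "insert v (insert p N)"] N True v by auto
    have "w \<noteq> v"
      using trapezoid_pair_not_mem[OF pw] \<epsilon> True w assms(2) by auto
    have "v \<noteq> p" "w \<noteq> p"
      using pv pw by (auto simp: trapezoid_pair_def)
    have "trapezoid_pair d N \<epsilon> v w"
      unfolding trapezoid_pair_def
    proof (intro conjI ballI)
      show "v \<noteq> w"
        using \<open>w \<noteq> v\<close> by simp
      fix x y assume xy: "x \<in> N" "y \<in> N"
      then have in_M: "x \<in> M" "y \<in> M" "p \<in> M" "v \<in> M" "w \<in> M"
        using N True v w assms(2) by auto
      \<comment> \<open>Both distances are routed through \<open>p\<close>, and the four legs are
        regrouped so that each bracket is controlled by one of the two pairs.\<close>
      have "(1 - \<epsilon>) * (d x y + d v w) \<le>
          (1 - \<epsilon>) * ((d p x + d p v) + (d p y + d p w))"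
        using triangle[of x p y] triangle[of v p w] in_M \<epsilon>
        by (intro mult_left_mono) (auto simp: commute)
      also have "\<dots> = (1 - \<epsilon>) * (d p x + d p v) + (1 - \<epsilon>) * (d p y + d p w)"
        by (simp add: distrib_left)
      also have "\<dots> \<le> d x v + d y w"
        using trapezoid_pairD[OF pv, of p x] trapezoid_pairD[OF pw, of p y] xy in_M by simp
      finally show "(1 - \<epsilon>) * (d x y + d v w) \<le> d x v + d y w" .
    qed
    with contra v w \<open>v \<noteq> p\<close> \<open>w \<noteq> p\<close> show False
      by blast
  qed
qed

lemma long_trapezoid_property_remove_finite:
  assumes "long_trapezoid_property M d" "finite F"
  shows "long_trapezoid_property (M - F) d"
  using assms(2)
proof induction
  case empty
  then show ?case using assms(1) by simp
next
  case (insert p F)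
  have "M - insert p F = (M - F) - {p}"
    by blast
  then show ?case
    using long_trapezoid_property_remove1[OF insert.IH] by auto
qed

section \<open>The two directions for l1 sums\<close>

lemma long_trapezoid_property_l1_sum_left:
  assumes sum: "is_l1_sum M d z S T" and S: "long_trapezoid_property S d"
  shows "long_trapezoid_property M d"
proof (rule long_trapezoid_propertyI)
  fix N and \<epsilon> :: real
  assume N: "finite N" "N \<subseteq> M" and \<epsilon>: "0 < \<epsilon>" "\<epsilon> < 1"
  have un: "M = S \<union> T" and z: "z \<in> S" "z \<in> M"
    and sum_d: "\<And>x y. x \<in> S \<Longrightarrow> y \<in> T \<Longrightarrow> d x y = d x z + d z y"
    using sum by (auto simp: is_l1_sum_def)
  have "finite (insert z (N \<inter> S)) \<and> insert z (N \<inter> S) \<subseteq> S \<and> \<epsilon> > 0"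
    using N z \<epsilon> by auto
  then obtain u v where uv: "u \<in> S" "v \<in> S" and
      pair: "trapezoid_pair d (insert z (N \<inter> S)) \<epsilon> u v"
    using S unfolding long_trapezoid_property_iff by meson
  \<comment> \<open>The retraction onto \<open>S\<close> fixes \<open>S\<close> and sends the rest
    to \<open>z\<close>. Since \<open>x'\<close> lies exactly between \<open>x\<close> and every
    point of \<open>S\<close>, replacing \<open>x\<close>, \<open>y\<close> by \<open>x'\<close>,
    \<open>y'\<close> lowers the right side by \<open>d x x' + d y y'\<close>, and
    \<open>d x y\<close> drops by at most that amount.\<close>
  have retract: "\<exists>x'\<in>insert z (N \<inter> S). \<forall>s\<in>S. d x s = d x x' + d x' s" if "x \<in> N" for x
  proof (cases "x \<in> S")
    case True
    then show ?thesis
      using that un by (intro bexI[of _ x]) auto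
  next
    case False
    then have "x \<in> T"
      using that N un by auto
    then show ?thesis
      using sum_d[of _ x] by (intro bexI[of _ z]) (auto simp: commute)
  qed
  have "trapezoid_pair d N \<epsilon> u v"
    unfolding trapezoid_pair_def
  proof (intro conjI ballI)
    show "u \<noteq> v"
      using pair by (simp add: trapezoid_pair_def)
    fix x y assume xy: "x \<in> N" "y \<in> N"
    obtain x' where x': "x' \<in> insert z (N \<inter> S)" "d x u = d x x' + d x' u"
      using retract[OF xy(1)] uv by blast
    obtain y' where y': "y' \<in> insert z (N \<inter> S)" "d y v = d y y' + d y' v"
      using retract[OF xy(2)] uv by blast
    have in_M: "x \<in> M" "y \<in> M" "x' \<in> M" "y' \<in> M"
      using xy x' y' N z by auto
    have "d x y \<le> d x x' + d x' y' + d y y'"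
      using triangle[of x x' y] triangle[of x' y' y] in_M by (simp add: commute)
    then have "(1 - \<epsilon>) * (d x y + d u v) \<le>
        (1 - \<epsilon>) * ((d x x' + d y y') + (d x' y' + d u v))"
      using \<epsilon> by (intro mult_left_mono) auto
    also have "\<dots> = (1 - \<epsilon>) * (d x x' + d y y') + (1 - \<epsilon>) * (d x' y' + d u v)"
      by (rule distrib_left)
    also have "\<dots> \<le> (d x x' + d y y') + (d x' u + d y' v)"
      using \<epsilon> trapezoid_pairD[OF pair x'(1) y'(1)]
      by (intro add_mono mult_left_le_one_le) auto
    finally show "(1 - \<epsilon>) * (d x y + d u v) \<le> d x u + d y v"
      using x' y' by simp
  qed
  then show "\<exists>u\<in>M. \<exists>v\<in>M. trapezoid_pair d N \<epsilon> u v"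
    using uv un by blast
qed

text \<open>Every path from \<open>S\<close> to \<open>v\<close> passes through \<open>z\<close>, so
  \<open>d z v\<close> cancels from both sides except for a loss of
  \<open>\<epsilon> * d z v\<close>. By \<open>le\<close> this is at most
  \<open>\<epsilon> * d u z\<close>, which the second \<epsilon> absorbs.\<close>

lemma trapezoid_pair_l1_sum_base:
  assumes sum: "is_l1_sum M d z S T" and "N \<subseteq> S"
    and pair: "trapezoid_pair d N \<epsilon> u v" and "u \<in> S" "v \<in> T"
    and le: "d z v \<le> d u z" and "0 \<le> \<epsilon>"
  shows "trapezoid_pair d N (2 * \<epsilon>) u z"
  unfolding trapezoid_pair_def
proof (intro conjI ballI)
  have un: "M = S \<union> T" and z: "z \<in> M"
    and sum_d: "\<And>x y. x \<in> S \<Longrightarrow> y \<in> T \<Longrightarrow> d x y = d x z + d z y"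
    using sum by (auto simp: is_l1_sum_def)
  \<comment> \<open>If \<open>u\<close> were \<open>z\<close>, then \<open>le\<close> would also
    force \<open>v\<close> to be \<open>z\<close>, collapsing the given pair.\<close>
  show "u \<noteq> z"
  proof
    assume "u = z"
    then have "d z v \<le> 0"
      using le z by simp
    then have "v = z"
      using z \<open>v \<in> T\<close> un zero[of z v] nonneg[of z v] by auto
    then show False
      using pair \<open>u = z\<close> by (simp add: trapezoid_pair_def)
  qed
  fix x y assume xy: "x \<in> N" "y \<in> N"
  have "d u v = d u z + d z v" "d y v = d y z + d z v"
    using sum_d xy assms by auto
  then have "(1 - \<epsilon>) * (d x y + (d u z + d z v)) \<le> d x u + (d y z + d z v)"
    using trapezoid_pairD[OF pair xy] by simp
  moreover have "0 \<le> \<epsilon> * (d u z - d z v)" "0 \<le> \<epsilon> * d x y"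
    using le \<open>0 \<le> \<epsilon>\<close> by auto
  ultimately show "(1 - 2 * \<epsilon>) * (d x y + d u z) \<le> d x u + d y z"
    by (simp add: algebra_simps)
qed

text \<open>Which summand a pair favours may depend on the set and the tolerance. Arguing by
  contradiction fixes one obstruction in each summand, and a single pair for their union then has to
  violate one of them.\<close>

lemma long_trapezoid_property_l1_sum_cases:
  assumes sum: "is_l1_sum M d z S T" and M: "long_trapezoid_property M d"
  shows "long_trapezoid_property S d \<or> long_trapezoid_property T d"
proof (rule ccontr)
  assume "\<not> ?thesis"
  then have not: "\<not> long_trapezoid_property S d" "\<not> long_trapezoid_property T d"
    by auto
  obtain A \<alpha> where A: "finite A" "A \<subseteq> S" "\<alpha> > 0"
      "\<And>u v. u \<in> S \<Longrightarrow> v \<in> S \<Longrightarrow> \<not> trapezoid_pair d A \<alpha> u v"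
    using not(1) unfolding long_trapezoid_property_iff by blast
  obtain B \<beta> where B: "finite B" "B \<subseteq> T" "\<beta> > 0"
      "\<And>u v. u \<in> T \<Longrightarrow> v \<in> T \<Longrightarrow> \<not> trapezoid_pair d B \<beta> u v"
    using not(2) unfolding long_trapezoid_property_iff by blast
  \<comment> \<open>The half makes room for the doubling that mixed pairs incur.\<close>
  define \<epsilon> where "\<epsilon> = min \<alpha> \<beta> / 2"
  have \<epsilon>: "\<epsilon> > 0" "2 * \<epsilon> \<le> \<alpha>" "2 * \<epsilon> \<le> \<beta>"
    using A(3) B(3) by (auto simp: \<epsilon>_def)
  have un: "M = S \<union> T" and z: "z \<in> S" "z \<in> T"
    using sum by (auto simp: is_l1_sum_def)
  have "finite (A \<union> B) \<and> A \<union> B \<subseteq> M \<and> \<epsilon> > 0"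
    using A B \<epsilon> un by auto
  then obtain u v where uv: "u \<in> M" "v \<in> M" and pair: "trapezoid_pair d (A \<union> B) \<epsilon> u v"
    using M unfolding long_trapezoid_property_iff by meson
  have no_S: "\<not> trapezoid_pair d A \<epsilon>' u' v'" if "\<epsilon>' \<le> 2 * \<epsilon>" "u' \<in> S" "v' \<in> S" for \<epsilon>' u' v'
    using that A(4) \<epsilon> trapezoid_pair_mono[of A \<epsilon>' u' v' \<alpha>] by auto
  have no_T: "\<not> trapezoid_pair d B \<epsilon>' u' v'" if "\<epsilon>' \<le> 2 * \<epsilon>" "u' \<in> T" "v' \<in> T" for \<epsilon>' u' v'
    using that B(4) \<epsilon> trapezoid_pair_mono[of B \<epsilon>' u' v' \<beta>] by auto
  have sum': "is_l1_sum M d z T S"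
    using is_l1_sum_commute Metric_space_axioms sum .
  have mixed: False
    if u: "u \<in> S" and v: "v \<in> T" and pair: "trapezoid_pair d (A \<union> B) \<epsilon> u v" for u v
  \<comment> \<open>The point farther from \<open>z\<close> is kept and the other one is replaced by
    \<open>z\<close>; the second case exchanges the roles of \<open>S\<close> and
    \<open>T\<close>.\<close>
  proof (cases "d z v \<le> d u z")
    case True
    have "trapezoid_pair d A \<epsilon> u v"
      using pair by (rule trapezoid_pair_subset) auto
    then have "trapezoid_pair d A (2 * \<epsilon>) u z"
      using trapezoid_pair_l1_sum_base[OF sum A(2)] u v True \<epsilon> by auto
    then show False
      using no_S[of "2 * \<epsilon>"] u z by auto
  next
    case False
    have "trapezoid_pair d B \<epsilon> v u"
      using trapezoid_pair_sym[OF pair] by (rule trapezoid_pair_subset) auto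
    moreover have "d z u \<le> d v z"
      using False by (simp add: commute)
    ultimately have "trapezoid_pair d B (2 * \<epsilon>) v z"
      using trapezoid_pair_l1_sum_base[OF sum' B(2)] u v \<epsilon> by auto
    then show False
      using no_T[of "2 * \<epsilon>"] v z by auto
  qed
  \<comment> \<open>Pairs inside one summand are excluded by its obstruction, so only mixed pairs
    remain, in either order.\<close>
  have "trapezoid_pair d A \<epsilon> u v" "trapezoid_pair d B \<epsilon> u v"
    using pair by (auto elim: trapezoid_pair_subset)
  then have "\<not> (u \<in> S \<and> v \<in> S)" "\<not> (u \<in> T \<and> v \<in> T)"
    using no_S[of \<epsilon>] no_T[of \<epsilon>] \<epsilon> by auto
  then show False
    using mixed[OF _ _ pair] mixed[OF _ _ trapezoid_pair_sym[OF pair]] uv un by blast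
qed

end

theorem proposition3p8:
  fixes M :: "'a set" and d :: "'a \<Rightarrow> 'a \<Rightarrow> real" and z :: 'a
  assumes "Metric_space M d" and "z \<in> M"
  shows "(\<forall>T\<^sub>1 T\<^sub>2. is_l1_sum M d z T\<^sub>1 T\<^sub>2 \<longrightarrow>
            (long_trapezoid_property M d \<longleftrightarrow>
              long_trapezoid_property T\<^sub>1 d \<or> long_trapezoid_property T\<^sub>2 d))
       \<and> (\<forall>N\<^sub>1. long_trapezoid_property M d \<and> N\<^sub>1 \<subseteq> M \<and> finite (M - N\<^sub>1) \<longrightarrow>
            long_trapezoid_property N\<^sub>1 d)"
proof -
  interpret Metric_space M d by fact
  show ?thesis
  proof (intro conjI allI impI)
    fix T\<^sub>1 T\<^sub>2
    assume sum: "is_l1_sum M d z T\<^sub>1 T\<^sub>2"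
    show "long_trapezoid_property M d \<longleftrightarrow>
        long_trapezoid_property T\<^sub>1 d \<or> long_trapezoid_property T\<^sub>2 d"
      using long_trapezoid_property_l1_sum_cases[OF sum]
        long_trapezoid_property_l1_sum_left[OF sum]
        long_trapezoid_property_l1_sum_left[OF is_l1_sum_commute[OF assms(1) sum]]
      by blast
  next
    fix N\<^sub>1
    assume "long_trapezoid_property M d \<and> N\<^sub>1 \<subseteq> M \<and> finite (M - N\<^sub>1)"
    moreover from this have "M - (M - N\<^sub>1) = N\<^sub>1"
      by blast
    ultimately show "long_trapezoid_property N\<^sub>1 d"
      using long_trapezoid_property_remove_finite[of "M - N\<^sub>1"] by simp
  qed
qed

end
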